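(* For all closed terms $P,Q$ over $\Sigma_{SCL}(A)$, $\mathrm{MSCL}\vdash P=Q$ if and only if $\mathit{mse}(P)=\mathit{mse}(Q)$.
   Context: $A$ is a non-empty set of atoms; closed terms over $\Sigma_{SCL}(A)$: $P::=a\mid\mathsf T\mid\mathsf F\mid\neg P\mid P\land_s P\mid P\lor_s P$ ($a\in A$), with $\land_s,\lor_s$ sequential (short-circuit) conjunction and disjunction. $\mathrm{MSCL}\vdash s=t$ (for terms over $\Sigma_{SCL}(A)$) means $s=t$ is derivable in equational logic from the following equations over $\Sigma_{SCL}(A)$ extended with Hoare's conditional $x\lhd y\rhd z$: (CP1) $x\lhd\mathsf T\rhd y=x$, (CP2) $x\lhd\mathsf F\rhd y=y$, (CP3) $\mathsf T\lhd x\rhd\mathsf F=x$, (CP4) $x\lhd(y\lhd z\rhd u)\rhd v=(x\lhd y\rhd v)\lhd z\rhd(x\lhd u\rhd v)$, (CPmem) $x\lhd y\rhd(z\lhd u\rhd(v\lhd y\rhd w))=x\lhd y\rhd(z\lhd u\rhd w)$, $\neg x=\mathsf F\lhd x\rhd\mathsf T$, $x\land_s y=y\lhd x\rhd\mathsf F$, $x\lor_s y=\mathsf T\lhd x\rhd y$. Evaluation trees $\mathcal T_A$: generated by $\mathsf T,\mathsf F$ and $X\unlhd a\unrhd Y$ ($a\in A$; root $a$, left branch $X$, right branch $Y$). Leaf replacement $X[\mathsf T\mapsto Y,\mathsf F\mapsto Z]$ replaces $\mathsf T$-leaves by $Y$ and $\mathsf F$-leaves by $Z$. $se(\mathsf T)=\mathsf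 T$, $se(\mathsf F)=\mathsf F$, $se(a)=\mathsf T\unlhd a\unrhd\mathsf F$, $se(\neg P)=se(P)[\mathsf T\mapsto\mathsf F,\mathsf F\mapsto\mathsf T]$, $se(P\land_s Q)=se(P)[\mathsf T\mapsto se(Q)]$, $se(P\lor_s Q)=se(P)[\mathsf F\mapsto se(Q)]$. $\mathit{mse}(P)=m(se(P))$ where $m(\mathsf T)=\mathsf T$, $m(\mathsf F)=\mathsf F$, $m(X\unlhd a\unrhd Y)=m(L_a(X))\unlhd a\unrhd m(R_a(Y))$; $L_a,R_a$ fix $\mathsf T,\mathsf F$, $L_a(X\unlhd b\unrhd Y)=L_a(X)$ if $b=a$ and $L_a(X)\unlhd b\unrhd L_a(Y)$ otherwise, $R_a(X\unlhd b\unrhd Y)=R_a(Y)$ if $b=a$ and $R_a(X)\unlhd b\unrhd R_a(Y)$ otherwise. *)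

theory Defs
  imports Main
begin

text \<open>Closed terms over $\Sigma_{SCL}(A)$. The non-empty set $A$ of atoms is the type \<open>'a\<close>;
  every HOL type is non-empty.\<close>

datatype 'a scl =
    Atom 'a
  | Tr
  | Fl
  | Neg "'a scl"
  | And "'a scl" "'a scl"
  | Or "'a scl" "'a scl"

text \<open>Open terms over $\Sigma_{SCL}(A)$ extended with Hoare's conditional, with variables drawn
  from the countably infinite set of natural numbers.\<close>

datatype 'a trm =
    Var nat
  | TAtom 'a
  | TTr  (\<open>\<^bold>T\<close>)
  | TFl  (\<open>\<^bold>F\<close>)
  | TNeg "'a trm"  (\<open>\<^bold>\<not> _\<close> [90] 90)
  | TAnd "'a trm" "'a trm"  (infixr \<open>\<and>\<^sub>s\<close> 85)
  | TOr "'a trm" "'a trm"  (infixr \<open>\<or>\<^sub>s\<close> 80)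
  | TCond "'a trm" "'a trm" "'a trm"  (\<open>_ \<lhd> _ \<rhd> _\<close> [76, 76, 76] 75)

primrec trm_of :: "'a scl \<Rightarrow> 'a trm" where
  "trm_of (Atom a) = TAtom a"
| "trm_of Tr = \<^bold>T"
| "trm_of Fl = \<^bold>F"
| "trm_of (Neg P) = \<^bold>\<not> trm_of P"
| "trm_of (And P Q) = trm_of P \<and>\<^sub>s trm_of Q"
| "trm_of (Or P Q) = trm_of P \<or>\<^sub>s trm_of Q"

primrec subst :: "(nat \<Rightarrow> 'a trm) \<Rightarrow> 'a trm \<Rightarrow> 'a trm" where
  "subst \<sigma> (Var n) = \<sigma> n"
| "subst \<sigma> (TAtom a) = TAtom a"
| "subst \<sigma> \<^bold>T = \<^bold>T"
| "subst \<sigma> \<^bold>F = \<^bold>F"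
| "subst \<sigma> (\<^bold>\<not> s) = \<^bold>\<not> subst \<sigma> s"
| "subst \<sigma> (s \<and>\<^sub>s t) = subst \<sigma> s \<and>\<^sub>s subst \<sigma> t"
| "subst \<sigma> (s \<or>\<^sub>s t) = subst \<sigma> s \<or>\<^sub>s subst \<sigma> t"
| "subst \<sigma> (s \<lhd> t \<rhd> r) = subst \<sigma> s \<lhd> subst \<sigma> t \<rhd> subst \<sigma> r"

inductive derivable :: "('a trm \<times> 'a trm) set \<Rightarrow> 'a trm \<Rightarrow> 'a trm \<Rightarrow> bool"
  (\<open>_ \<turnstile> _ \<approx> _\<close> [51, 51, 51] 50)
  for E where
  ax: "(s, t) \<in> E \<Longrightarrow> E \<turnstile> s \<approx> t"
| refl: "E \<turnstile> s \<approx> s"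
| sym: "E \<turnstile> s \<approx> t \<Longrightarrow> E \<turnstile> t \<approx> s"
| trans: "E \<turnstile> s \<approx> t \<Longrightarrow> E \<turnstile> t \<approx> r \<Longrightarrow> E \<turnstile> s \<approx> r"
| inst: "E \<turnstile> s \<approx> t \<Longrightarrow> E \<turnstile> subst \<sigma> s \<approx> subst \<sigma> t"
| cong_neg: "E \<turnstile> s \<approx> s' \<Longrightarrow> E \<turnstile> \<^bold>\<not> s \<approx> \<^bold>\<not> s'"
| cong_and: "E \<turnstile> s \<approx> s' \<Longrightarrow> E \<turnstile> t \<approx> t' \<Longrightarrow> E \<turnstile> s \<and>\<^sub>s t \<approx> s' \<and>\<^sub>s t'"
| cong_or: "E \<turnstile> s \<approx> s' \<Longrightarrow> E \<turnstile> t \<approx> t' \<Longrightarrow> E \<turnstile> s \<or>\<^sub>s t \<approx> s' \<or>\<^sub>s t'"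
| cong_cond: "E \<turnstile> s \<approx> s' \<Longrightarrow> E \<turnstile> t \<approx> t' \<Longrightarrow> E \<turnstile> r \<approx> r' \<Longrightarrow>
    E \<turnstile> s \<lhd> t \<rhd> r \<approx> s' \<lhd> t' \<rhd> r'"

definition MSCL :: "('a trm \<times> 'a trm) set" where
  "MSCL =
    (let x = Var 0; y = Var 1; z = Var 2; u = Var 3; v = Var 4; w = Var 5 in
     {(x \<lhd> \<^bold>T \<rhd> y, x),
      (x \<lhd> \<^bold>F \<rhd> y, y),
      (\<^bold>T \<lhd> x \<rhd> \<^bold>F, x),
      (x \<lhd> (y \<lhd> z \<rhd> u) \<rhd> v, (x \<lhd> y \<rhd> v) \<lhd> z \<rhd> (x \<lhd> u \<rhd> v)),
      (x \<lhd> y \<rhd> (z \<lhd> u \<rhd> (v \<lhd> y \<rhd> w)), x \<lhd> y \<rhd> (z \<lhd> u \<rhd> w)),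
      (\<^bold>\<not> x, \<^bold>F \<lhd> x \<rhd> \<^bold>T),
      (x \<and>\<^sub>s y, y \<lhd> x \<rhd> \<^bold>F),
      (x \<or>\<^sub>s y, \<^bold>T \<lhd> x \<rhd> y)})"

text \<open>In \<open>X \<unlhd> a \<unrhd> Y\<close> the left branch \<open>X\<close> is taken when the atom \<open>a\<close> evaluates to true.\<close>

datatype 'a tree =
    LeafT
  | LeafF
  | Node "'a tree" 'a "'a tree"  (\<open>_ \<unlhd> _ \<unrhd> _\<close> [76, 76, 76] 75)

text \<open>\<open>leaf_replace X Y Z\<close> is $X[\mathsf T\mapsto Y,\mathsf F\mapsto Z]$; in the single replacements
  $X[\mathsf T\mapsto Y]$ and $X[\mathsf F\mapsto Z]$ the other kind of leaf is kept.\<close>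

primrec leaf_replace :: "'a tree \<Rightarrow> 'a tree \<Rightarrow> 'a tree \<Rightarrow> 'a tree" where
  "leaf_replace LeafT Y Z = Y"
| "leaf_replace LeafF Y Z = Z"
| "leaf_replace (X1 \<unlhd> a \<unrhd> X2) Y Z = leaf_replace X1 Y Z \<unlhd> a \<unrhd> leaf_replace X2 Y Z"

primrec se :: "'a scl \<Rightarrow> 'a tree" where
  "se (Atom a) = LeafT \<unlhd> a \<unrhd> LeafF"
| "se Tr = LeafT"
| "se Fl = LeafF"
| "se (Neg P) = leaf_replace (se P) LeafF LeafT"
| "se (And P Q) = leaf_replace (se P) (se Q) LeafF"
| "se (Or P Q) = leaf_replace (se P) LeafT (se Q)"

text \<open>\<open>memL a\<close>, \<open>memR a\<close> and \<open>memo\<close> are written $L_a$, $R_a$ and $m$ in the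
  literature.\<close>

primrec memL :: "'a \<Rightarrow> 'a tree \<Rightarrow> 'a tree" where
  "memL a LeafT = LeafT"
| "memL a LeafF = LeafF"
| "memL a (X \<unlhd> b \<unrhd> Y) = (if b = a then memL a X else memL a X \<unlhd> b \<unrhd> memL a Y)"

primrec memR :: "'a \<Rightarrow> 'a tree \<Rightarrow> 'a tree" where
  "memR a LeafT = LeafT"
| "memR a LeafF = LeafF"
| "memR a (X \<unlhd> b \<unrhd> Y) = (if b = a then memR a Y else memR a X \<unlhd> b \<unrhd> memR a Y)"

lemma size_memL: "size (memL a X) \<le> size X"
  by (induction X) auto

lemma size_memR: "size (memR a X) \<le> size X"
  by (induction X) auto

function memo :: "'a tree \<Rightarrow> 'a tree" where
  "memo LeafT = LeafT"
| "memo LeafF = LeafF"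
| "memo (X \<unlhd> a \<unrhd> Y) = memo (memL a X) \<unlhd> a \<unrhd> memo (memR a Y)"
  by pat_completeness auto
termination
  by (relation "measure size")
    (auto simp: less_Suc_eq_le intro: trans_le_add1 trans_le_add2 size_memL size_memR)

definition mse :: "'a scl \<Rightarrow> 'a tree" where
  "mse P = memo (se P)"

end

theory Submission
  imports Defs
begin

text \<open>Soundness: interpret a term as the function that sends a valuation of the atoms to the list
  of atoms queried, in order of their first query, together with the result. A repeated evaluation
  under the same valuation queries nothing new and gives the same result, so this is a model of
  \<open>MSCL\<close>; and a memorising evaluation tree can be read off from this function.

  Completeness: reading evaluation trees as nested conditionals, every closed term is derivably
  equal to its evaluation tree, and CPmem derives the transformation \<open>memo\<close>.\<close>

section \<open>The model of query sequences\<close>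

type_synonym 'a behaviour = "('a \<Rightarrow> bool) \<Rightarrow> 'a list \<times> bool"

text \<open>Atoms of \<open>l\<close> are already in memory, so only queries new to \<open>l\<close>
  are recorded behind it.\<close>

definition after :: "'a list \<Rightarrow> 'a list \<times> bool \<Rightarrow> 'a list \<times> bool" where
  "after l r = (l @ filter (\<lambda>a. a \<notin> set l) (fst r), snd r)"

lemma after_Nil [simp]: "after [] r = r"
  by (simp add: after_def)

text \<open>Associativity: both sides drop from \<open>q\<close> exactly the atoms seen in
  \<open>l\<close> or in \<open>r\<close>. This is what CP4 needs.\<close>

lemma after_after: "after (fst (after l r)) q = after l (after (fst r) q)"
  by (auto simp: after_def intro!: filter_cong)

lemma after_absorb: "after l (after l' (after l r)) = after l (after l' r)"
  by (auto simp: after_def intro!: filter_cong)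

lemma snd_after [simp]: "snd (after l r) = snd r"
  by (simp add: after_def)

text \<open>Hoare's conditional in the model: \<open>q\<close> runs first, and the chosen branch
  inherits its queries as memory.\<close>

definition branch :: "'a behaviour \<Rightarrow> 'a behaviour \<Rightarrow> 'a behaviour \<Rightarrow> 'a behaviour" where
  "branch p q r f = after (fst (q f)) (if snd (q f) then p f else r f)"

lemma branch_const [simp]:
  "branch p (\<lambda>f. ([], True)) r = p"
  "branch p (\<lambda>f. ([], False)) r = r"
  "branch (\<lambda>f. ([], True)) q (\<lambda>f. ([], False)) = q"
  by (auto simp: branch_def after_def fun_eq_iff prod_eq_iff)

lemma branch_branch:
  "branch x (branch y z u) v = branch (branch x y v) z (branch x u v)"
  by (rule ext) (simp add: branch_def after_after)

text \<open>The inner \<open>y\<close> is reached only if the outer one was false; under the same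
  valuation it is false again, and \<open>after_absorb\<close> removes its repeated queries.\<close>

lemma branch_mem:
  "branch x y (branch z u (branch v y w)) = branch x y (branch z u w)"
  by (rule ext) (simp add: branch_def after_absorb)

primrec sem :: "(nat \<Rightarrow> 'a behaviour) \<Rightarrow> 'a trm \<Rightarrow> 'a behaviour" where
  "sem \<rho> (Var n) = \<rho> n"
| "sem \<rho> (TAtom a) = (\<lambda>f. ([a], f a))"
| "sem \<rho> \<^bold>T = (\<lambda>f. ([], True))"
| "sem \<rho> \<^bold>F = (\<lambda>f. ([], False))"
| "sem \<rho> (\<^bold>\<not> s) = branch (\<lambda>f. ([], False)) (sem \<rho> s) (\<lambda>f. ([], True))"
| "sem \<rho> (s \<and>\<^sub>s t) = branch (sem \<rho> t) (sem \<rho> s) (\<lambda>f. ([], False))"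
| "sem \<rho> (s \<or>\<^sub>s t) = branch (\<lambda>f. ([], True)) (sem \<rho> s) (sem \<rho> t)"
| "sem \<rho> (s \<lhd> t \<rhd> r) = branch (sem \<rho> s) (sem \<rho> t) (sem \<rho> r)"

lemma sem_subst: "sem \<rho> (subst \<sigma> t) = sem (\<lambda>n. sem \<rho> (\<sigma> n)) t"
  by (induction t) simp_all

lemma sem_MSCL: "(s, t) \<in> MSCL \<Longrightarrow> sem \<rho> s = sem \<rho> t"
  by (auto simp: MSCL_def Let_def branch_branch branch_mem)

lemma soundness: "MSCL \<turnstile> s \<approx> t \<Longrightarrow> sem \<rho> s = sem \<rho> t"
  by (induction arbitrary: \<rho> rule: derivable.induct) (simp_all add: sem_MSCL sem_subst)

section \<open>Evaluation trees in the model\<close>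

primrec run :: "'a tree \<Rightarrow> 'a behaviour" where
  "run LeafT = (\<lambda>f. ([], True))"
| "run LeafF = (\<lambda>f. ([], False))"
| "run (X \<unlhd> a \<unrhd> Y) = branch (run X) (\<lambda>f. ([a], f a)) (run Y)"

lemma run_leaf_replace: "run (leaf_replace X Y Z) = branch (run Y) (run X) (run Z)"
  by (induction X) (simp_all add: branch_branch)

lemma sem_trm_of: "sem \<rho> (trm_of P) = run (se P)"
  by (induction P) (simp_all add: run_leaf_replace)

text \<open>Setting \<open>a\<close> to true sends every query of \<open>a\<close> to the left, as
  \<open>memL\<close> does; the filter deletes that query.\<close>

lemma run_memL:
  "run (memL a X) f = (filter (\<lambda>b. b \<noteq> a) (fst (run X (f(a := True)))), snd (run X (f(a := True))))"
  by (induction X) (auto simp: prod_eq_iff branch_def after_def conj_commute)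

lemma run_memR:
  "run (memR a X) f = (filter (\<lambda>b. b \<noteq> a) (fst (run X (f(a := False)))), snd (run X (f(a := False))))"
  by (induction X) (auto simp: prod_eq_iff branch_def after_def conj_commute)

text \<open>No query means a leaf. Otherwise the first query is the root, and fixing its value
  determines the behaviour of each pruned branch, so the recursion of \<open>memo\<close> can be
  followed.\<close>

lemma memo_eq_if_run_eq: "run X = run Y \<Longrightarrow> memo X = memo Y"
proof (induction X arbitrary: Y rule: memo.induct)
  case (3 X a X' Z)
  then obtain Y b Y' where Z: "Z = Y \<unlhd> b \<unrhd> Y'"
    by (cases Z) (auto simp: fun_eq_iff prod_eq_iff branch_def after_def)
  have eq: "run (X \<unlhd> a \<unrhd> X') f = run (Y \<unlhd> b \<unrhd> Y') f" for f
    using 3 Z by simp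
  then have ab: "a = b"
    by (simp add: prod_eq_iff branch_def after_def)
  have "run (memL a X) = run (memL a Y)"
  proof
    fix f
    show "run (memL a X) f = run (memL a Y) f"
      \<comment> \<open>Here both trees go left, and the queries recorded after the root are those
        other than \<open>a\<close>.\<close>
      using eq[of "f(a := True)"] by (simp add: ab run_memL prod_eq_iff branch_def after_def)
  qed
  moreover have "run (memR a X') = run (memR a Y')"
  proof
    fix f
    show "run (memR a X') f = run (memR a Y') f"
      using eq[of "f(a := False)"] by (simp add: ab run_memR prod_eq_iff branch_def after_def)
  qed
  ultimately show ?case
    using 3(1,2) Z ab by simp
next
  case 1
  then show ?case
    by (cases Y) (auto simp: fun_eq_iff prod_eq_iff branch_def after_def)
next
  case 2
  then show ?case
    by (cases Y) (auto simp: fun_eq_iff prod_eq_iff branch_def after_def)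
qed

section \<open>Deriving the memorising transformation\<close>

text \<open>Indexing the list serves as the substitution; the axioms contain only variables 0 to
  5.\<close>

lemma MSCL_instance:
  assumes "(s, t) \<in> MSCL"
  shows "MSCL \<turnstile> subst ((!) [x, y, z, u, v, w]) s \<approx> subst ((!) [x, y, z, u, v, w]) t"
  using assms by (intro derivable.inst derivable.ax)

context
  notes MSCL_def [simp] Let_def [simp]
begin

lemma CP1: "MSCL \<turnstile> x \<lhd> \<^bold>T \<rhd> y \<approx> x"
  using MSCL_instance[of "Var 0 \<lhd> \<^bold>T \<rhd> Var 1" "Var 0" x y] by simp

lemma CP2: "MSCL \<turnstile> x \<lhd> \<^bold>F \<rhd> y \<approx> y"
  using MSCL_instance[of "Var 0 \<lhd> \<^bold>F \<rhd> Var 1" "Var 1" x y] by simp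

lemma CP3: "MSCL \<turnstile> \<^bold>T \<lhd> x \<rhd> \<^bold>F \<approx> x"
  using MSCL_instance[of "\<^bold>T \<lhd> Var 0 \<rhd> \<^bold>F" "Var 0" x] by simp

lemma CP4: "MSCL \<turnstile> x \<lhd> (y \<lhd> z \<rhd> u) \<rhd> v \<approx> (x \<lhd> y \<rhd> v) \<lhd> z \<rhd> (x \<lhd> u \<rhd> v)"
  using MSCL_instance[of "Var 0 \<lhd> (Var 1 \<lhd> Var 2 \<rhd> Var 3) \<rhd> Var 4"
      "(Var 0 \<lhd> Var 1 \<rhd> Var 4) \<lhd> Var 2 \<rhd> (Var 0 \<lhd> Var 3 \<rhd> Var 4)" x y z u v] by simp

lemma CPmem: "MSCL \<turnstile> x \<lhd> y \<rhd> (z \<lhd> u \<rhd> (v \<lhd> y \<rhd> w)) \<approx> x \<lhd> y \<rhd> (z \<lhd> u \<rhd> w)"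
  using MSCL_instance[of "Var 0 \<lhd> Var 1 \<rhd> (Var 2 \<lhd> Var 3 \<rhd> (Var 4 \<lhd> Var 1 \<rhd> Var 5))"
      "Var 0 \<lhd> Var 1 \<rhd> (Var 2 \<lhd> Var 3 \<rhd> Var 5)" x y z u v w] by simp

lemma neg_cond: "MSCL \<turnstile> \<^bold>\<not> x \<approx> \<^bold>F \<lhd> x \<rhd> \<^bold>T"
  using MSCL_instance[of "\<^bold>\<not> Var 0" "\<^bold>F \<lhd> Var 0 \<rhd> \<^bold>T" x] by simp

lemma and_cond: "MSCL \<turnstile> x \<and>\<^sub>s y \<approx> y \<lhd> x \<rhd> \<^bold>F"
  using MSCL_instance[of "Var 0 \<and>\<^sub>s Var 1" "Var 1 \<lhd> Var 0 \<rhd> \<^bold>F" x y] by simp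

lemma or_cond: "MSCL \<turnstile> x \<or>\<^sub>s y \<approx> \<^bold>T \<lhd> x \<rhd> y"
  using MSCL_instance[of "Var 0 \<or>\<^sub>s Var 1" "\<^bold>T \<lhd> Var 0 \<rhd> Var 1" x y] by simp

end

lemmas [trans] = derivable.trans
lemmas trm_cong = derivable.cong_cond derivable.refl

lemma cond_swap: "MSCL \<turnstile> x \<lhd> (\<^bold>F \<lhd> y \<rhd> \<^bold>T) \<rhd> z \<approx> z \<lhd> y \<rhd> x"
  by (rule derivable.trans[OF CP4]) (intro trm_cong CP1 CP2)

text \<open>Mirror image of CPmem for the left inner branch: negate \<open>u\<close>, apply CPmem,
  swap back.\<close>

lemma CPmem': "MSCL \<turnstile> x \<lhd> y \<rhd> ((v \<lhd> y \<rhd> w) \<lhd> u \<rhd> z) \<approx> x \<lhd> y \<rhd> (w \<lhd> u \<rhd> z)"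
proof -
  let ?u = "\<^bold>F \<lhd> u \<rhd> \<^bold>T"
  have "MSCL \<turnstile> x \<lhd> y \<rhd> ((v \<lhd> y \<rhd> w) \<lhd> u \<rhd> z) \<approx> x \<lhd> y \<rhd> (z \<lhd> ?u \<rhd> (v \<lhd> y \<rhd> w))"
    by (intro trm_cong derivable.sym[OF cond_swap])
  also have "MSCL \<turnstile> \<dots> \<approx> x \<lhd> y \<rhd> (z \<lhd> ?u \<rhd> w)"
    by (rule CPmem)
  also have "MSCL \<turnstile> \<dots> \<approx> x \<lhd> y \<rhd> (w \<lhd> u \<rhd> z)"
    by (intro trm_cong cond_swap)
  finally show ?thesis .
qed

lemma cond_contract: "MSCL \<turnstile> x \<lhd> y \<rhd> (v \<lhd> y \<rhd> w) \<approx> x \<lhd> y \<rhd> w"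
proof -
  have "MSCL \<turnstile> x \<lhd> y \<rhd> (v \<lhd> y \<rhd> w) \<approx> x \<lhd> y \<rhd> (\<^bold>T \<lhd> \<^bold>F \<rhd> (v \<lhd> y \<rhd> w))"
    by (intro trm_cong derivable.sym[OF CP2])
  also have "MSCL \<turnstile> \<dots> \<approx> x \<lhd> y \<rhd> (\<^bold>T \<lhd> \<^bold>F \<rhd> w)"
    by (rule CPmem)
  also have "MSCL \<turnstile> \<dots> \<approx> x \<lhd> y \<rhd> w"
    by (intro trm_cong CP2)
  finally show ?thesis .
qed

section \<open>Evaluation trees as terms\<close>

primrec tree_trm :: "'a tree \<Rightarrow> 'a trm" where
  "tree_trm LeafT = \<^bold>T"
| "tree_trm LeafF = \<^bold>F"
| "tree_trm (X \<unlhd> a \<unrhd> Y) = tree_trm X \<lhd> TAtom a \<rhd> tree_trm Y"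

lemma tree_trm_leaf_replace:
  "MSCL \<turnstile> tree_trm Y \<lhd> tree_trm X \<rhd> tree_trm Z \<approx> tree_trm (leaf_replace X Y Z)"
proof (induction X)
  case (Node X1 a X2)
  then show ?case
    by (auto intro: derivable.trans[OF CP4] trm_cong)
qed (simp_all add: CP1 CP2)

text \<open>Each connective unfolds to a conditional, which leaf replacement evaluates; an atom is
  expanded by CP3.\<close>

lemma trm_of_derivable_se: "MSCL \<turnstile> trm_of P \<approx> tree_trm (se P)"
proof (induction P)
  case (Neg P)
  have "MSCL \<turnstile> \<^bold>\<not> trm_of P \<approx> \<^bold>F \<lhd> trm_of P \<rhd> \<^bold>T"
    by (rule neg_cond)
  also have "MSCL \<turnstile> \<dots> \<approx> \<^bold>F \<lhd> tree_trm (se P) \<rhd> \<^bold>T"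
    by (intro trm_cong Neg)
  also have "MSCL \<turnstile> \<dots> \<approx> tree_trm (se (Neg P))"
    using tree_trm_leaf_replace[of LeafF "se P" LeafT] by simp
  finally show ?case by simp
next
  case (And P Q)
  have "MSCL \<turnstile> trm_of P \<and>\<^sub>s trm_of Q \<approx> trm_of Q \<lhd> trm_of P \<rhd> \<^bold>F"
    by (rule and_cond)
  also have "MSCL \<turnstile> \<dots> \<approx> tree_trm (se Q) \<lhd> tree_trm (se P) \<rhd> \<^bold>F"
    by (intro trm_cong And)
  also have "MSCL \<turnstile> \<dots> \<approx> tree_trm (se (And P Q))"
    using tree_trm_leaf_replace[of "se Q" "se P" LeafF] by simp
  finally show ?case by simp
next
  case (Or P Q)
  have "MSCL \<turnstile> trm_of P \<or>\<^sub>s trm_of Q \<approx> \<^bold>T \<lhd> trm_of P \<rhd> trm_of Q"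
    by (rule or_cond)
  also have "MSCL \<turnstile> \<dots> \<approx> \<^bold>T \<lhd> tree_trm (se P) \<rhd> tree_trm (se Q)"
    by (intro trm_cong Or)
  also have "MSCL \<turnstile> \<dots> \<approx> tree_trm (se (Or P Q))"
    using tree_trm_leaf_replace[of LeafT "se P" "se Q"] by simp
  finally show ?case by simp
qed (simp_all add: derivable.refl derivable.sym[OF CP3])

text \<open>The term \<open>y\<close> is the atom \<open>a\<close> for \<open>memR\<close>, and its negation for \<open>memL\<close>.\<close>

lemma cond_nested:
  assumes "\<And>x. MSCL \<turnstile> x \<lhd> y \<rhd> s \<approx> x \<lhd> y \<rhd> s'"
    and "\<And>x. MSCL \<turnstile> x \<lhd> y \<rhd> t \<approx> x \<lhd> y \<rhd> t'"
  shows "MSCL \<turnstile> x \<lhd> y \<rhd> (s \<lhd> u \<rhd> t) \<approx> x \<lhd> y \<rhd> (s' \<lhd> u \<rhd> t')"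
proof -
  \<comment> \<open>Memory read backwards plants a test of \<open>y\<close> above \<open>s\<close>,
    where the assumption applies; then it is erased. The same is done for \<open>t\<close>.\<close>
  have "MSCL \<turnstile> x \<lhd> y \<rhd> (s \<lhd> u \<rhd> t) \<approx> x \<lhd> y \<rhd> ((x \<lhd> y \<rhd> s) \<lhd> u \<rhd> t)"
    by (rule derivable.sym[OF CPmem'])
  also have "MSCL \<turnstile> \<dots> \<approx> x \<lhd> y \<rhd> ((x \<lhd> y \<rhd> s') \<lhd> u \<rhd> t)"
    by (intro trm_cong assms)
  also have "MSCL \<turnstile> \<dots> \<approx> x \<lhd> y \<rhd> (s' \<lhd> u \<rhd> t)"
    by (rule CPmem')
  also have "MSCL \<turnstile> \<dots> \<approx> x \<lhd> y \<rhd> (s' \<lhd> u \<rhd> (x \<lhd> y \<rhd> t))"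
    by (rule derivable.sym[OF CPmem])
  also have "MSCL \<turnstile> \<dots> \<approx> x \<lhd> y \<rhd> (s' \<lhd> u \<rhd> (x \<lhd> y \<rhd> t'))"
    by (intro trm_cong assms)
  also have "MSCL \<turnstile> \<dots> \<approx> x \<lhd> y \<rhd> (s' \<lhd> u \<rhd> t')"
    by (rule CPmem)
  finally show ?thesis .
qed

text \<open>A repeated test of \<open>a\<close> contracts to its right branch; other tests are
  passed by \<open>cond_nested\<close>.\<close>

lemma cond_memR:
  "MSCL \<turnstile> x \<lhd> TAtom a \<rhd> tree_trm X \<approx> x \<lhd> TAtom a \<rhd> tree_trm (memR a X)"
proof (induction X arbitrary: x)
  case (Node X b Y)
  show ?case
  proof (cases "b = a")
    case True
    then show ?thesis
      using derivable.trans[OF cond_contract Node.IH(2)] by simp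
  next
    case False
    then show ?thesis
      using cond_nested[OF Node.IH] by simp
  qed
qed (simp_all add: derivable.refl)

lemma cond_neg_memL:
  fixes a :: 'a
  defines "y \<equiv> \<^bold>F \<lhd> TAtom a \<rhd> \<^bold>T"
  shows "MSCL \<turnstile> x \<lhd> y \<rhd> tree_trm X \<approx> x \<lhd> y \<rhd> tree_trm (memL a X)"
proof (induction X arbitrary: x)
  case (Node X b Y)
  show ?case
  proof (cases "b = a")
    case True
    \<comment> \<open>Rewriting the inner test of \<open>a\<close> as one of \<open>y\<close>
      exchanges its branches, so contraction keeps \<open>X\<close>.\<close>
    have "MSCL \<turnstile> x \<lhd> y \<rhd> (tree_trm X \<lhd> TAtom a \<rhd> tree_trm Y)
        \<approx> x \<lhd> y \<rhd> (tree_trm Y \<lhd> y \<rhd> tree_trm X)"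
      unfolding y_def by (intro trm_cong derivable.sym[OF cond_swap])
    also have "MSCL \<turnstile> \<dots> \<approx> x \<lhd> y \<rhd> tree_trm X"
      by (rule cond_contract)
    also have "MSCL \<turnstile> \<dots> \<approx> x \<lhd> y \<rhd> tree_trm (memL a X)"
      by (rule Node.IH)
    finally show ?thesis
      using True by simp
  next
    case False
    then show ?thesis
      using cond_nested[OF Node.IH] by simp
  qed
qed (simp_all add: derivable.refl)

text \<open>Negating the test moves the left branch to the right, where it is pruned before swapping
  back.\<close>

lemma cond_memL:
  "MSCL \<turnstile> tree_trm X \<lhd> TAtom a \<rhd> x \<approx> tree_trm (memL a X) \<lhd> TAtom a \<rhd> x"
  by (rule derivable.trans[OF derivable.sym[OF cond_swap] derivable.trans[OF cond_neg_memL cond_swap]])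

lemma tree_trm_memo: "MSCL \<turnstile> tree_trm X \<approx> tree_trm (memo X)"
proof (induction X rule: memo.induct)
  case (3 X a Y)
  have "MSCL \<turnstile> tree_trm X \<lhd> TAtom a \<rhd> tree_trm Y
      \<approx> tree_trm (memL a X) \<lhd> TAtom a \<rhd> tree_trm (memR a Y)"
    by (rule derivable.trans[OF cond_memL cond_memR])
  also have "MSCL \<turnstile> \<dots> \<approx> tree_trm (memo (memL a X)) \<lhd> TAtom a \<rhd> tree_trm (memo (memR a Y))"
    by (intro trm_cong 3)
  finally show ?case by simp
qed (simp_all add: derivable.refl)

lemma trm_of_derivable_mse: "MSCL \<turnstile> trm_of P \<approx> tree_trm (mse P)"
  unfolding mse_def by (rule derivable.trans[OF trm_of_derivable_se tree_trm_memo])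

theorem theorem5p8:
  fixes P Q :: "'a scl"
  shows "MSCL \<turnstile> trm_of P \<approx> trm_of Q \<longleftrightarrow> mse P = mse Q"
proof
  assume "MSCL \<turnstile> trm_of P \<approx> trm_of Q"
  then have "run (se P) = run (se Q)"
    \<comment> \<open>Closed terms have no variables, so any choice of \<open>\<rho>\<close> gives
      the behaviour of the tree.\<close>
    using soundness sem_trm_of by metis
  then show "mse P = mse Q"
    unfolding mse_def by (rule memo_eq_if_run_eq)
next
  assume "mse P = mse Q"
  then show "MSCL \<turnstile> trm_of P \<approx> trm_of Q"
    using trm_of_derivable_mse derivable.trans derivable.sym by metis
qed

end
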